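(* Let $\mathcal{A}$ be an $\mathrm{LE}$-$\mathcal{FALC}$ ABox and $\overline{\mathcal{A}}$ its completion, and suppose $\overline{\mathcal{A}}$ contains no clash. Then the interpretation $\mathcal{M}=(\mathfrak{F},\cdot^\mathcal{M})$ constructed from $\overline{\mathcal{A}}$ is a model of $\mathcal{A}$.
   Context: $\mathbf{H}$ is a complete and completely distributive Heyting algebra. ABox assertions are $\alpha\le t$ and $\alpha\not\le t$ ($\alpha\in\mathbf{H}$, $t$ one of $I(b,y)$, $R_\Box(b,y)$, $R_\Diamond(y,b)$, $b:C$, $y::C$); $\mathcal{M}\vDash\alpha\le t$ iff $\alpha\le v^\mathcal{M}(t)$, where $v^\mathcal{M}(b:C)=[\![C]\!](b)$, $v^\mathcal{M}(y::C)=(\![C]\!)(y)$ and relational terms get the value of the interpreted relation; $\mathcal{M}\vDash\alpha\not\le t$ iff $\mathcal{M}\not\vDash\alpha\le t$. A clash is a pair $\alpha_1\le t$, $\alpha_2\not\le t$ with $\alpha_2\le\alpha_1$. The completion $\overline{\mathcal{A}}$ is the maximal expansion of $\mathcal{A}$ under the $\mathrm{LE}$-$\mathcal{FALC}$ tableaux rules (creation, basic $I$, connective, $\Box$, $\Diamond$, $I$-compatibility, inverse, adjunction rules introducing names $\Diamond^{\bullet} b,\Diamond b,\Box y,\blacksquare y$ with $\Diamond^{\bullet}$ the black-diamond left adjoint of $\Box$, negative, appending and $MV_\vee$ rules). The model construction: $A$, $X$ are the object and feature names in $\overline{\mathcal{A}}$ plus fresh $a_\top$, $x_\bot$ related to everything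 to degree $0$; $I(a,x)$, $R_\Box(a,x)$, $R_\Diamond(x,a)$ are the maximal $\alpha$ such that the corresponding assertion $\alpha\le\cdot$ occurs in $\overline{\mathcal{A}}$ ($0$ if none); names are interpreted as themselves; each primitive concept $D$ is interpreted as $(\{1/x_D\}^\downarrow,\{1/a_D\}^\uparrow)$.
   Formalization: The ABox is assumed finite and to contain no assertion 0 ≰ t: such an assertion is unsatisfiable, yet {0 ≰ I(b,y)} has a completion without a clash, so the claim fails for it as stated. *)

theory Defs
  imports Main
begin

section \<open>Fuzzy relations, formal contexts and concepts\<close>

text \<open>
  Truth values range over the class \<^class>\<open>complete_distrib_lattice\<close>, which is complete
  distributivity in the strong (arbitrary choice function) sense. Such a lattice is a Heyting
  algebra in exactly one way, with the following residual.
\<close>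

definition himp :: "'h::complete_distrib_lattice \<Rightarrow> 'h \<Rightarrow> 'h" (infixr "\<rightarrow>\<^sub>H" 60) where
  "a \<rightarrow>\<^sub>H b = Sup {c. inf a c \<le> b}"

lemma le_himp_iff: "c \<le> (a \<rightarrow>\<^sub>H b) \<longleftrightarrow> inf a c \<le> b"
proof
  assume "c \<le> (a \<rightarrow>\<^sub>H b)"
  then have "inf a c \<le> inf a (Sup {c. inf a c \<le> b})"
    by (simp add: himp_def le_infI2)
  also have "\<dots> \<le> b"
    unfolding inf_Sup by (rule SUP_least) simp
  finally show "inf a c \<le> b" .
next
  assume "inf a c \<le> b"
  then show "c \<le> (a \<rightarrow>\<^sub>H b)"
    by (simp add: himp_def Sup_upper)
qed

text \<open>
  A fuzzy relation \<open>R\<close> between carriers \<open>U\<close> and \<open>W\<close> induces the two maps $R^{(1)}$ and $R^{(0)}$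
  between fuzzy subsets. Fuzzy subsets are total functions; only their values on the carrier matter.
\<close>

definition rel1 :: "'u set \<Rightarrow> ('u \<Rightarrow> 'w \<Rightarrow> 'h::complete_distrib_lattice) \<Rightarrow> ('u \<Rightarrow> 'h) \<Rightarrow> 'w \<Rightarrow> 'h" where
  "rel1 U R f w = (INF u\<in>U. f u \<rightarrow>\<^sub>H R u w)"

definition rel0 :: "'w set \<Rightarrow> ('u \<Rightarrow> 'w \<Rightarrow> 'h::complete_distrib_lattice) \<Rightarrow> ('w \<Rightarrow> 'h) \<Rightarrow> 'u \<Rightarrow> 'h" where
  "rel0 W R g u = (INF w\<in>W. g w \<rightarrow>\<^sub>H R u w)"

definition single :: "'h::complete_distrib_lattice \<Rightarrow> 'u \<Rightarrow> 'u \<Rightarrow> 'h" where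
  "single \<beta> u = (\<lambda>v. if v = u then \<beta> else bot)"


section \<open>Syntax\<close>

text \<open>\<open>'r\<close> and \<open>'s\<close> index the roles $R_\Box$ and $R_\Diamond$, \<open>'c\<close> the primitive concepts.\<close>

datatype ('c, 'r, 's) concept =
    Prim 'c
  | Conj "('c, 'r, 's) concept" "('c, 'r, 's) concept"
  | Disj "('c, 'r, 's) concept" "('c, 'r, 's) concept"
  | BoxC 'r "('c, 'r, 's) concept"
  | DiaC 's "('c, 'r, 's) concept"

primrec subconcepts :: "('c, 'r, 's) concept \<Rightarrow> ('c, 'r, 's) concept set" where
  "subconcepts (Prim D) = {Prim D}"
| "subconcepts (Conj C1 C2) = insert (Conj C1 C2) (subconcepts C1 \<union> subconcepts C2)"
| "subconcepts (Disj C1 C2) = insert (Disj C1 C2) (subconcepts C1 \<union> subconcepts C2)"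
| "subconcepts (BoxC r C) = insert (BoxC r C) (subconcepts C)"
| "subconcepts (DiaC s C) = insert (DiaC s C) (subconcepts C)"

text \<open>
  \<open>Inc b y\<close> is $I(b,y)$, \<open>RBox r b y\<close> is $R_\Box(b,y)$, \<open>RDia s y b\<close> is $R_\Diamond(y,b)$,
  \<open>MemO b C\<close> is $b : C$ and \<open>MemF y C\<close> is $y :: C$. Object names \<open>'o\<close> and feature names \<open>'f\<close> are
  parameters: input ABoxes use given names, their completions use the names defined further below.
\<close>

datatype (term_objs: 'o, term_feats: 'f, dead 'c, dead 'r, dead 's) fterm =
    Inc 'o 'f
  | RBox 'r 'o 'f
  | RDia 's 'f 'o
  | MemO 'o "('c, 'r, 's) concept"
  | MemF 'f "('c, 'r, 's) concept"

text \<open>\<open>AtLeast \<alpha> t\<close> is $\alpha \leq t$ and \<open>NotAtLeast \<alpha> t\<close> is $\alpha \not\leq t$.\<close>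

datatype (obj_names: 'o, feat_names: 'f, dead 'c, dead 'r, dead 's, dead 'h) assertion =
    AtLeast 'h "('o, 'f, 'c, 'r, 's) fterm"
  | NotAtLeast 'h "('o, 'f, 'c, 'r, 's) fterm"

primrec term_concepts :: "('o, 'f, 'c, 'r, 's) fterm \<Rightarrow> ('c, 'r, 's) concept set" where
  "term_concepts (Inc b y) = {}"
| "term_concepts (RBox r b y) = {}"
| "term_concepts (RDia s y b) = {}"
| "term_concepts (MemO b C) = subconcepts C"
| "term_concepts (MemF y C) = subconcepts C"

primrec concepts_in :: "('o, 'f, 'c, 'r, 's, 'h) assertion \<Rightarrow> ('c, 'r, 's) concept set" where
  "concepts_in (AtLeast \<alpha> t) = term_concepts t"
| "concepts_in (NotAtLeast \<alpha> t) = term_concepts t"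


section \<open>Semantics\<close>

record ('p, 'q, 'a, 'x, 'c, 'r, 's, 'h) interp =
  objs :: "'p set"
  feats :: "'q set"
  inc :: "'p \<Rightarrow> 'q \<Rightarrow> 'h"
  rbox :: "'r \<Rightarrow> 'p \<Rightarrow> 'q \<Rightarrow> 'h"
  rdia :: "'s \<Rightarrow> 'q \<Rightarrow> 'p \<Rightarrow> 'h"
  oname :: "'a \<Rightarrow> 'p"
  fname :: "'x \<Rightarrow> 'q"
  prim :: "'c \<Rightarrow> ('p \<Rightarrow> 'h) \<times> ('q \<Rightarrow> 'h)"

context
  fixes M :: "('p, 'q, 'a, 'x, 'c, 'r, 's, 'h::complete_distrib_lattice) interp"
begin

definition up :: "('p \<Rightarrow> 'h) \<Rightarrow> 'q \<Rightarrow> 'h" where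
  "up = rel1 (objs M) (inc M)"

definition down :: "('q \<Rightarrow> 'h) \<Rightarrow> 'p \<Rightarrow> 'h" where
  "down = rel0 (feats M) (inc M)"

definition stable_obj :: "('p \<Rightarrow> 'h) \<Rightarrow> bool" where
  "stable_obj f \<longleftrightarrow> (\<forall>a\<in>objs M. down (up f) a = f a)"

definition stable_feat :: "('q \<Rightarrow> 'h) \<Rightarrow> bool" where
  "stable_feat u \<longleftrightarrow> (\<forall>x\<in>feats M. up (down u) x = u x)"

definition is_concept :: "('p \<Rightarrow> 'h) \<times> ('q \<Rightarrow> 'h) \<Rightarrow> bool" where
  "is_concept c \<longleftrightarrow> (\<forall>x\<in>feats M. up (fst c) x = snd c x) \<and> (\<forall>a\<in>objs M. down (snd c) a = fst c a)"

definition compat_box :: "('p \<Rightarrow> 'q \<Rightarrow> 'h) \<Rightarrow> bool" where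
  "compat_box R \<longleftrightarrow>
     (\<forall>\<beta>. \<forall>x\<in>feats M. stable_obj (rel0 (feats M) R (single \<beta> x))) \<and>
     (\<forall>\<beta>. \<forall>a\<in>objs M. stable_feat (rel1 (objs M) R (single \<beta> a)))"

definition compat_dia :: "('q \<Rightarrow> 'p \<Rightarrow> 'h) \<Rightarrow> bool" where
  "compat_dia R \<longleftrightarrow>
     (\<forall>\<beta>. \<forall>a\<in>objs M. stable_feat (rel0 (objs M) R (single \<beta> a))) \<and>
     (\<forall>\<beta>. \<forall>x\<in>feats M. stable_obj (rel1 (feats M) R (single \<beta> x)))"

definition is_interp :: bool where
  "is_interp \<longleftrightarrow>
     (\<forall>r. compat_box (rbox M r)) \<and> (\<forall>s. compat_dia (rdia M s)) \<and>
     (\<forall>b. oname M b \<in> objs M) \<and> (\<forall>y. fname M y \<in> feats M) \<and>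
     (\<forall>D. is_concept (prim M D))"

primrec concept_val :: "('c, 'r, 's) concept \<Rightarrow> ('p \<Rightarrow> 'h) \<times> ('q \<Rightarrow> 'h)" where
  "concept_val (Prim D) = prim M D"
| "concept_val (Conj C1 C2) =
     (let f = (\<lambda>a. inf (fst (concept_val C1) a) (fst (concept_val C2) a)) in (f, up f))"
| "concept_val (Disj C1 C2) =
     (let u = (\<lambda>x. inf (snd (concept_val C1) x) (snd (concept_val C2) x)) in (down u, u))"
| "concept_val (BoxC r C) =
     (let f = rel0 (feats M) (rbox M r) (snd (concept_val C)) in (f, up f))"
| "concept_val (DiaC s C) =
     (let u = rel0 (objs M) (rdia M s) (fst (concept_val C)) in (down u, u))"

primrec term_val :: "('a, 'x, 'c, 'r, 's) fterm \<Rightarrow> 'h" where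
  "term_val (Inc b y) = inc M (oname M b) (fname M y)"
| "term_val (RBox r b y) = rbox M r (oname M b) (fname M y)"
| "term_val (RDia s y b) = rdia M s (fname M y) (oname M b)"
| "term_val (MemO b C) = fst (concept_val C) (oname M b)"
| "term_val (MemF y C) = snd (concept_val C) (fname M y)"

primrec sat :: "('a, 'x, 'c, 'r, 's, 'h) assertion \<Rightarrow> bool" where
  "sat (AtLeast \<alpha> t) \<longleftrightarrow> \<alpha> \<le> term_val t"
| "sat (NotAtLeast \<alpha> t) \<longleftrightarrow> \<not> \<alpha> \<le> term_val t"

definition is_model :: "('a, 'x, 'c, 'r, 's, 'h) assertion set \<Rightarrow> bool" where
  "is_model \<A> \<longleftrightarrow> is_interp \<and> (\<forall>\<phi>\<in>\<A>. sat \<phi>)"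

end


section \<open>Tableau completion\<close>

text \<open>
  The names occurring in completions: the given names, the classifying names $a_C$ and $x_C$, and
  the names introduced by the adjunction rules.
\<close>

datatype ('a, 'c, 'r, 's) tobj =
    ObjName 'a
  | ClassObj "('c, 'r, 's) concept"
  | DiaObj 's "('a, 'c, 'r, 's) tobj"
  | BDiaObj 'r "('a, 'c, 'r, 's) tobj"

datatype ('x, 'c, 'r, 's) tfeat =
    FeatName 'x
  | ClassFeat "('c, 'r, 's) concept"
  | BoxFeat 'r "('x, 'c, 'r, 's) tfeat"
  | BBoxFeat 's "('x, 'c, 'r, 's) tfeat"

text \<open>
  The names $\Diamond b$ and $\Box y$ are new except that $\Diamond a_C = a_{\Diamond C}$ and
  $\Box x_C = x_{\Box C}$. The rules use the following functions in place of the constructors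
  \<open>DiaObj\<close> and \<open>BoxFeat\<close>.
\<close>

fun dia_name :: "'s \<Rightarrow> ('a, 'c, 'r, 's) tobj \<Rightarrow> ('a, 'c, 'r, 's) tobj" where
  "dia_name s (ClassObj C) = ClassObj (DiaC s C)"
| "dia_name s b = DiaObj s b"

fun box_name :: "'r \<Rightarrow> ('x, 'c, 'r, 's) tfeat \<Rightarrow> ('x, 'c, 'r, 's) tfeat" where
  "box_name r (ClassFeat C) = ClassFeat (BoxC r C)"
| "box_name r y = BoxFeat r y"

type_synonym ('a, 'x, 'c, 'r, 's, 'h) tassertion =
  "(('a, 'c, 'r, 's) tobj, ('x, 'c, 'r, 's) tfeat, 'c, 'r, 's, 'h) assertion"

text \<open>
  The least ABox containing \<open>\<A>\<close> and closed under the expansion rules. Side conditions of the form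
  ``$C$ occurs in the ABox'' refer to the ABox being expanded.
\<close>

inductive_set completion ::
  "('a, 'x, 'c, 'r, 's, 'h::complete_distrib_lattice) assertion set \<Rightarrow> ('a, 'x, 'c, 'r, 's, 'h) tassertion set"
  for \<A> :: "('a, 'x, 'c, 'r, 's, 'h) assertion set" where
  input: "\<phi> \<in> \<A> \<Longrightarrow> map_assertion ObjName FeatName \<phi> \<in> completion \<A>"
| create_obj: "\<phi> \<in> completion \<A> \<Longrightarrow> C \<in> concepts_in \<phi> \<Longrightarrow>
    AtLeast top (MemO (ClassObj C) C) \<in> completion \<A>"
| create_feat: "\<phi> \<in> completion \<A> \<Longrightarrow> C \<in> concepts_in \<phi> \<Longrightarrow>
    AtLeast top (MemF (ClassFeat C) C) \<in> completion \<A>"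
| basic: "AtLeast \<alpha>1 (MemO b C) \<in> completion \<A> \<Longrightarrow> AtLeast \<alpha>2 (MemF y C) \<in> completion \<A> \<Longrightarrow>
    AtLeast (inf \<alpha>1 \<alpha>2) (Inc b y) \<in> completion \<A>"
| conj1: "AtLeast \<alpha> (MemO b (Conj C1 C2)) \<in> completion \<A> \<Longrightarrow> AtLeast \<alpha> (MemO b C1) \<in> completion \<A>"
| conj2: "AtLeast \<alpha> (MemO b (Conj C1 C2)) \<in> completion \<A> \<Longrightarrow> AtLeast \<alpha> (MemO b C2) \<in> completion \<A>"
| disj1: "AtLeast \<alpha> (MemF y (Disj C1 C2)) \<in> completion \<A> \<Longrightarrow> AtLeast \<alpha> (MemF y C1) \<in> completion \<A>"
| disj2: "AtLeast \<alpha> (MemF y (Disj C1 C2)) \<in> completion \<A> \<Longrightarrow> AtLeast \<alpha> (MemF y C2) \<in> completion \<A>"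
| box: "AtLeast \<alpha>1 (MemO b (BoxC r C)) \<in> completion \<A> \<Longrightarrow> AtLeast \<alpha>2 (MemF y C) \<in> completion \<A> \<Longrightarrow>
    AtLeast (inf \<alpha>1 \<alpha>2) (RBox r b y) \<in> completion \<A>"
| dia: "AtLeast \<alpha>1 (MemF y (DiaC s C)) \<in> completion \<A> \<Longrightarrow> AtLeast \<alpha>2 (MemO b C) \<in> completion \<A> \<Longrightarrow>
    AtLeast (inf \<alpha>1 \<alpha>2) (RDia s y b) \<in> completion \<A>"
| compat_box_feat: "AtLeast \<alpha> (Inc b (box_name r y)) \<in> completion \<A> \<Longrightarrow>
    AtLeast \<alpha> (RBox r b y) \<in> completion \<A>"
| compat_bbox_feat: "AtLeast \<alpha> (Inc b (BBoxFeat s y)) \<in> completion \<A> \<Longrightarrow>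
    AtLeast \<alpha> (RDia s y b) \<in> completion \<A>"
| compat_dia_obj: "AtLeast \<alpha> (Inc (dia_name s b) y) \<in> completion \<A> \<Longrightarrow>
    AtLeast \<alpha> (RDia s y b) \<in> completion \<A>"
| compat_bdia_obj: "AtLeast \<alpha> (Inc (BDiaObj r b) y) \<in> completion \<A> \<Longrightarrow>
    AtLeast \<alpha> (RBox r b y) \<in> completion \<A>"
| conj_inv: "AtLeast \<alpha>1 (MemO b C1) \<in> completion \<A> \<Longrightarrow> AtLeast \<alpha>2 (MemO b C2) \<in> completion \<A> \<Longrightarrow>
    \<phi> \<in> completion \<A> \<Longrightarrow> Conj C1 C2 \<in> concepts_in \<phi> \<Longrightarrow>
    AtLeast (inf \<alpha>1 \<alpha>2) (MemO b (Conj C1 C2)) \<in> completion \<A>"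
| disj_inv: "AtLeast \<alpha>1 (MemF y C1) \<in> completion \<A> \<Longrightarrow> AtLeast \<alpha>2 (MemF y C2) \<in> completion \<A> \<Longrightarrow>
    \<phi> \<in> completion \<A> \<Longrightarrow> Disj C1 C2 \<in> concepts_in \<phi> \<Longrightarrow>
    AtLeast (inf \<alpha>1 \<alpha>2) (MemF y (Disj C1 C2)) \<in> completion \<A>"
| adj_bdia_obj: "AtLeast \<alpha> (RBox r b y) \<in> completion \<A> \<Longrightarrow>
    AtLeast \<alpha> (Inc (BDiaObj r b) y) \<in> completion \<A>"
| adj_box_feat: "AtLeast \<alpha> (RBox r b y) \<in> completion \<A> \<Longrightarrow>
    AtLeast \<alpha> (Inc b (box_name r y)) \<in> completion \<A>"
| adj_dia_obj: "AtLeast \<alpha> (RDia s y b) \<in> completion \<A> \<Longrightarrow>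
    AtLeast \<alpha> (Inc (dia_name s b) y) \<in> completion \<A>"
| adj_bbox_feat: "AtLeast \<alpha> (RDia s y b) \<in> completion \<A> \<Longrightarrow>
    AtLeast \<alpha> (Inc b (BBoxFeat s y)) \<in> completion \<A>"
| neg_obj: "NotAtLeast \<alpha> (MemO b C) \<in> completion \<A> \<Longrightarrow>
    NotAtLeast \<alpha> (Inc b (ClassFeat C)) \<in> completion \<A>"
| neg_feat: "NotAtLeast \<alpha> (MemF y C) \<in> completion \<A> \<Longrightarrow>
    NotAtLeast \<alpha> (Inc (ClassObj C) y) \<in> completion \<A>"
| append_obj: "AtLeast \<alpha> (Inc b (ClassFeat C)) \<in> completion \<A> \<Longrightarrow>
    AtLeast \<alpha> (MemO b C) \<in> completion \<A>"
| append_feat: "AtLeast \<alpha> (Inc (ClassObj C) y) \<in> completion \<A> \<Longrightarrow>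
    AtLeast \<alpha> (MemF y C) \<in> completion \<A>"
| mv_join: "AtLeast \<alpha>1 t \<in> completion \<A> \<Longrightarrow> AtLeast \<alpha>2 t \<in> completion \<A> \<Longrightarrow>
    AtLeast (sup \<alpha>1 \<alpha>2) t \<in> completion \<A>"

text \<open>
  An assertion $0 \not\leq t$ is unsatisfiable but need not take part in a clash, since $0 \leq t$ need not
  be listed explicitly. ABoxes containing such an assertion have to be excluded separately.
\<close>

definition has_clash :: "('o, 'f, 'c, 'r, 's, 'h::complete_distrib_lattice) assertion set \<Rightarrow> bool" where
  "has_clash S \<longleftrightarrow> (\<exists>\<alpha>1 \<alpha>2 t. AtLeast \<alpha>1 t \<in> S \<and> NotAtLeast \<alpha>2 t \<in> S \<and> \<alpha>2 \<le> \<alpha>1)"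


section \<open>The interpretation constructed from the completion\<close>

definition degree ::
  "('o, 'f, 'c, 'r, 's, 'h::complete_distrib_lattice) assertion set \<Rightarrow> ('o, 'f, 'c, 'r, 's) fterm \<Rightarrow> 'h" where
  "degree S t = (if \<exists>\<alpha>. AtLeast \<alpha> t \<in> S then (GREATEST \<alpha>. AtLeast \<alpha> t \<in> S) else bot)"

text \<open>
  The fresh object $a_\top$ and the fresh feature $x_\bot$ are both \<open>None\<close>.
  Each name and each primitive concept occurring in the ABox is interpreted as prescribed. The
  remaining ones, which do not matter for satisfaction but must have some interpretation, are sent
  to the fresh elements and to the greatest concept.
\<close>

context
  fixes \<A> :: "('a, 'x, 'c, 'r, 's, 'h::complete_distrib_lattice) assertion set"
begin

definition can_objs :: "('a, 'c, 'r, 's) tobj option set" where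
  "can_objs = insert None (Some ` (\<Union>\<phi>\<in>completion \<A>. obj_names \<phi>))"

definition can_feats :: "('x, 'c, 'r, 's) tfeat option set" where
  "can_feats = insert None (Some ` (\<Union>\<phi>\<in>completion \<A>. feat_names \<phi>))"

fun can_inc :: "('a, 'c, 'r, 's) tobj option \<Rightarrow> ('x, 'c, 'r, 's) tfeat option \<Rightarrow> 'h" where
  "can_inc (Some b) (Some y) = degree (completion \<A>) (Inc b y)"
| "can_inc _ _ = bot"

fun can_rbox :: "'r \<Rightarrow> ('a, 'c, 'r, 's) tobj option \<Rightarrow> ('x, 'c, 'r, 's) tfeat option \<Rightarrow> 'h" where
  "can_rbox r (Some b) (Some y) = degree (completion \<A>) (RBox r b y)"
| "can_rbox r _ _ = bot"

fun can_rdia :: "'s \<Rightarrow> ('x, 'c, 'r, 's) tfeat option \<Rightarrow> ('a, 'c, 'r, 's) tobj option \<Rightarrow> 'h" where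
  "can_rdia s (Some y) (Some b) = degree (completion \<A>) (RDia s y b)"
| "can_rdia s _ _ = bot"

definition can_prim ::
  "'c \<Rightarrow> (('a, 'c, 'r, 's) tobj option \<Rightarrow> 'h) \<times> (('x, 'c, 'r, 's) tfeat option \<Rightarrow> 'h)" where
  "can_prim D =
     (if \<exists>\<phi>\<in>completion \<A>. Prim D \<in> concepts_in \<phi>
      then (rel0 can_feats can_inc (single top (Some (ClassFeat (Prim D)))),
            rel1 can_objs can_inc (single top (Some (ClassObj (Prim D)))))
      else (\<lambda>_. top, rel1 can_objs can_inc (\<lambda>_. top)))"

definition can_interp ::
  "(('a, 'c, 'r, 's) tobj option, ('x, 'c, 'r, 's) tfeat option, 'a, 'x, 'c, 'r, 's, 'h) interp" where
  "can_interp =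
     \<lparr> objs = can_objs, feats = can_feats, inc = can_inc, rbox = can_rbox, rdia = can_rdia,
       oname = (\<lambda>b. if Some (ObjName b) \<in> can_objs then Some (ObjName b) else None),
       fname = (\<lambda>y. if Some (FeatName y) \<in> can_feats then Some (FeatName y) else None),
       prim = can_prim \<rparr>"

end

end

theory Submission
  imports Defs
begin

text \<open>
  Every truth value in the completion lies in the sublattice generated by the finitely many values
  of the ABox. This sublattice is finite, so the greatest degree of each term is attained by the
  rule for joins. The basic and appending rules give $I(a,x_C) \wedge I(a_C,x) \leq I(a,x)$, and
  creation gives $I(a_C,x_C) = 1$; hence $(I(\cdot,x_C), I(a_C,\cdot))$ is a concept whenever $C$
  occurs. By induction on $C$ it is the interpretation of $C$. Compatibility of the relations
  holds because the adjunction rules make each of their rows and columns a row or column of $I$.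
\<close>

section \<open>Residuals and finitely generated sublattices\<close>

lemma himp_bot [simp]: "(bot \<rightarrow>\<^sub>H b) = (top :: 'h::complete_distrib_lattice)"
  by (rule top_le) (simp add: le_himp_iff)

lemma himp_top [simp]: "(top \<rightarrow>\<^sub>H b) = (b :: 'h::complete_distrib_lattice)"
proof (rule antisym)
  have "inf top (top \<rightarrow>\<^sub>H b) \<le> b"
    by (subst le_himp_iff [symmetric]) simp
  then show "(top \<rightarrow>\<^sub>H b) \<le> b"
    by simp
qed (simp add: le_himp_iff)

lemma rel0_eq_rel1: "rel0 W R = rel1 W (\<lambda>w u. R u w)"
  by (simp add: rel0_def rel1_def fun_eq_iff)

text \<open>Away from \<open>a\<close> the singleton has value \<open>bot\<close>, whose residual is
  \<open>top\<close>, so only the factor at \<open>a\<close> contributes to the infimum.\<close>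

lemma rel1_single:
  assumes "a \<in> U"
  shows "rel1 U R (single \<beta> a) w = (\<beta> \<rightarrow>\<^sub>H R a w)"
proof (rule antisym)
  show "rel1 U R (single \<beta> a) w \<le> (\<beta> \<rightarrow>\<^sub>H R a w)"
    unfolding rel1_def by (rule INF_lower2 [OF assms]) (simp add: single_def)
qed (auto simp: rel1_def single_def intro: INF_greatest)

lemma rel0_single: "x \<in> W \<Longrightarrow> rel0 W R (single \<beta> x) u = (\<beta> \<rightarrow>\<^sub>H R u x)"
  by (simp add: rel0_eq_rel1 rel1_single)

text \<open>Disjunctive normal forms over \<open>V\<close>, with the empty join for
  \<open>bot\<close> and the empty meet for \<open>top\<close>. In this form finiteness is
  immediate, and distributivity is only called on for closure under \<open>inf\<close>.\<close>

definition sublattice_gen :: "'h::complete_distrib_lattice set \<Rightarrow> 'h set" where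
  "sublattice_gen V = (\<lambda>F. Sup (Inf ` F)) ` Pow (Pow V)"

lemma finite_sublattice_gen: "finite V \<Longrightarrow> finite (sublattice_gen V)"
  by (simp add: sublattice_gen_def)

lemma sublattice_gen_incl: "v \<in> V \<Longrightarrow> v \<in> sublattice_gen V"
  unfolding sublattice_gen_def by (rule image_eqI [where x = "{{v}}"]) auto

lemma sublattice_gen_top: "top \<in> sublattice_gen V"
  unfolding sublattice_gen_def by (rule image_eqI [where x = "{{}}"]) auto

lemma sublattice_gen_sup:
  assumes "a \<in> sublattice_gen V" "b \<in> sublattice_gen V"
  shows "sup a b \<in> sublattice_gen V"
proof -
  obtain F G where "F \<subseteq> Pow V" "G \<subseteq> Pow V" "a = Sup (Inf ` F)" "b = Sup (Inf ` G)"
    using assms by (auto simp: sublattice_gen_def)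
  then show ?thesis
    unfolding sublattice_gen_def
    by (intro image_eqI [where x = "F \<union> G"]) (auto simp: image_Un Sup_union_distrib)
qed

lemma sublattice_gen_inf:
  assumes "a \<in> sublattice_gen V" "b \<in> sublattice_gen V"
  shows "inf a b \<in> sublattice_gen V"
proof -
  obtain F G where FG: "F \<subseteq> Pow V" "G \<subseteq> Pow V" "a = Sup (Inf ` F)" "b = Sup (Inf ` G)"
    using assms by (auto simp: sublattice_gen_def)
  \<comment> \<open>Distributing the meet over both joins leaves one term
    \<open>inf (Inf P) (Inf Q)\<close> per pair, which is \<open>Inf (P \<union> Q)\<close>.\<close>
  let ?H = "(\<lambda>(P, Q). P \<union> Q) ` (F \<times> G)"
  have "inf a b = Sup (Inf ` ?H)"
  proof (rule antisym)
    have "inf a b = (SUP Q\<in>G. SUP P\<in>F. inf (Inf P) (Inf Q))"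
      by (simp add: FG inf_Sup Sup_inf image_image)
    also have "\<dots> \<le> Sup (Inf ` ?H)"
      by (intro SUP_least Sup_upper) (force simp: Inf_union_distrib [symmetric])
    finally show "inf a b \<le> Sup (Inf ` ?H)" .
    show "Sup (Inf ` ?H) \<le> inf a b"
      unfolding FG by (intro SUP_least) (auto simp: Inf_union_distrib intro: le_infI1 [OF SUP_upper] le_infI2 [OF SUP_upper])
  qed
  moreover have "?H \<subseteq> Pow V"
    using FG by auto
  ultimately show ?thesis
    by (auto simp: sublattice_gen_def)
qed


section \<open>Stability\<close>

lemma down_up_ge: "a \<in> objs M \<Longrightarrow> f a \<le> down M (up M f) a"
  unfolding down_def up_def rel0_def
proof (rule INF_greatest)
  fix x assume "a \<in> objs M"
  then have "rel1 (objs M) (inc M) f x \<le> (f a \<rightarrow>\<^sub>H inc M a x)"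
    unfolding rel1_def by (rule INF_lower)
  then show "f a \<le> (rel1 (objs M) (inc M) f x \<rightarrow>\<^sub>H inc M a x)"
    by (simp add: le_himp_iff inf_commute)
qed

lemma up_down_ge: "x \<in> feats M \<Longrightarrow> u x \<le> up M (down M u) x"
  unfolding down_def up_def rel1_def
proof (rule INF_greatest)
  fix a assume "x \<in> feats M"
  then have "rel0 (feats M) (inc M) u a \<le> (u x \<rightarrow>\<^sub>H inc M a x)"
    unfolding rel0_def by (rule INF_lower)
  then show "u x \<le> (rel0 (feats M) (inc M) u a \<rightarrow>\<^sub>H inc M a x)"
    by (simp add: le_himp_iff inf_commute)
qed

text \<open>Such an \<open>f\<close> is the \<open>down\<close> image of the singleton \<beta> at
  \<open>x\<close>, hence Galois closed: \<open>up M f x\<close> is at least \<beta>, so the factor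
  at \<open>x\<close> in \<open>down M (up M f) a\<close> is already at most
  \<open>f a\<close>.\<close>

lemma stable_obj_himp:
  assumes x: "x \<in> feats M" and f: "\<And>a. a \<in> objs M \<Longrightarrow> f a = (\<beta> \<rightarrow>\<^sub>H inc M a x)"
  shows "stable_obj M f"
  unfolding stable_obj_def
proof (intro ballI antisym)
  fix a assume a: "a \<in> objs M"
  have "\<beta> \<le> up M f x"
    unfolding up_def rel1_def
  proof (rule INF_greatest)
    fix a' assume "a' \<in> objs M"
    then have "inf \<beta> (f a') \<le> inc M a' x"
      using f by (simp flip: le_himp_iff)
    then show "\<beta> \<le> (f a' \<rightarrow>\<^sub>H inc M a' x)"
      by (simp add: le_himp_iff inf_commute)
  qed
  moreover have "down M (up M f) a \<le> (up M f x \<rightarrow>\<^sub>H inc M a x)"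
    unfolding down_def rel0_def using x by (rule INF_lower)
  ultimately have "inf \<beta> (down M (up M f) a) \<le> inc M a x"
    by (simp add: le_himp_iff) (meson inf_mono order_refl order_trans)
  then show "down M (up M f) a \<le> f a"
    using f [OF a] by (simp add: le_himp_iff)
qed (rule down_up_ge)

lemma stable_feat_himp:
  assumes a: "a \<in> objs M" and u: "\<And>x. x \<in> feats M \<Longrightarrow> u x = (\<beta> \<rightarrow>\<^sub>H inc M a x)"
  shows "stable_feat M u"
  unfolding stable_feat_def
proof (intro ballI antisym)
  fix x assume x: "x \<in> feats M"
  have "\<beta> \<le> down M u a"
    unfolding down_def rel0_def
  proof (rule INF_greatest)
    fix x' assume "x' \<in> feats M"
    then have "inf \<beta> (u x') \<le> inc M a x'"
      using u by (simp flip: le_himp_iff)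
    then show "\<beta> \<le> (u x' \<rightarrow>\<^sub>H inc M a x')"
      by (simp add: le_himp_iff inf_commute)
  qed
  moreover have "up M (down M u) x \<le> (down M u a \<rightarrow>\<^sub>H inc M a x)"
    unfolding up_def rel1_def using a by (rule INF_lower)
  ultimately have "inf \<beta> (up M (down M u) x) \<le> inc M a x"
    by (simp add: le_himp_iff) (meson inf_mono order_refl order_trans)
  then show "up M (down M u) x \<le> u x"
    using u [OF x] by (simp add: le_himp_iff)
qed (rule up_down_ge)

text \<open>By the singleton lemmas, the fuzzy sets to be tested are residuals \<beta> \<rightarrow>
  (column or row of \<open>R\<close>). If these are columns and rows of the incidence relation, the
  two preceding lemmas apply.\<close>

lemma compat_boxI:
  assumes "\<And>x. x \<in> feats M \<Longrightarrow> \<exists>x'\<in>feats M. \<forall>a\<in>objs M. R a x = inc M a x'"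
    and "\<And>a. a \<in> objs M \<Longrightarrow> \<exists>a'\<in>objs M. \<forall>x\<in>feats M. R a x = inc M a' x"
  shows "compat_box M R"
  unfolding compat_box_def
proof (intro conjI allI ballI)
  fix \<beta> x assume x: "x \<in> feats M"
  with assms(1) obtain x' where "x' \<in> feats M" "\<forall>a\<in>objs M. R a x = inc M a x'"
    by blast
  then show "stable_obj M (rel0 (feats M) R (single \<beta> x))"
    by (intro stable_obj_himp) (simp_all add: rel0_single [OF x])
next
  fix \<beta> a assume a: "a \<in> objs M"
  with assms(2) obtain a' where "a' \<in> objs M" "\<forall>x\<in>feats M. R a x = inc M a' x"
    by blast
  then show "stable_feat M (rel1 (objs M) R (single \<beta> a))"
    by (intro stable_feat_himp) (simp_all add: rel1_single [OF a])
qed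

text \<open>Transposing a relation exchanges \<open>rel0\<close> and \<open>rel1\<close>, which
  swaps the two conjuncts.\<close>

lemma compat_dia_iff_compat_box: "compat_dia M R \<longleftrightarrow> compat_box M (\<lambda>a x. R x a)"
  by (auto simp: compat_dia_def compat_box_def rel0_eq_rel1)


section \<open>Degrees in the completion\<close>

lemma subconcepts_refl [simp]: "C \<in> subconcepts C"
  by (cases C) auto

text \<open>The rules only copy values, introduce \<open>top\<close>, or form binary meets and
  joins. The separate equation keeps \<phi> a variable for the rule induction.\<close>

lemma completion_value:
  assumes "\<phi> \<in> completion \<A>" "\<phi> = AtLeast \<alpha> t"
  shows "\<alpha> \<in> sublattice_gen {\<alpha>. \<exists>t. AtLeast \<alpha> t \<in> \<A>}"
  using assms
proof (induction arbitrary: \<alpha> t rule: completion.induct)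
  case (input \<phi>)
  then show ?case
    by (cases \<phi>) (auto intro: sublattice_gen_incl)
qed (auto intro: sublattice_gen_top sublattice_gen_inf sublattice_gen_sup)

lemma finite_values:
  assumes "finite \<A>"
  shows "finite {\<alpha>. AtLeast \<alpha> t \<in> completion \<A>}"
proof -
  let ?V = "{\<alpha>. \<exists>t. AtLeast \<alpha> t \<in> \<A>}"
  have "?V \<subseteq> (\<lambda>\<phi>. case \<phi> of AtLeast \<alpha> t \<Rightarrow> \<alpha> | NotAtLeast \<alpha> t \<Rightarrow> \<alpha>) ` \<A>"
    by force
  then have "finite ?V"
    using assms finite_surj by blast
  then show ?thesis
    by (rule finite_subset [OF _ finite_sublattice_gen, rotated]) (auto dest: completion_value)
qed

lemma sup_closed_finite_greatest:
  fixes V :: "'h::semilattice_sup set"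
  assumes "finite V" "V \<noteq> {}" "\<And>a b. a \<in> V \<Longrightarrow> b \<in> V \<Longrightarrow> sup a b \<in> V"
  shows "\<exists>m\<in>V. \<forall>v\<in>V. v \<le> m"
proof -
  \<comment> \<open>The induction adds elements to a subset \<open>W\<close> while the bound stays
    in all of \<open>V\<close>, whose nonemptiness gives the base case.\<close>
  have "\<exists>m\<in>V. \<forall>v\<in>W. v \<le> m" if "finite W" "W \<subseteq> V" for W
    using that
  proof (induction W)
    case empty
    then show ?case
      using assms(2) by auto
  next
    case (insert w W)
    then obtain m where "m \<in> V" "\<forall>v\<in>W. v \<le> m"
      by auto
    then show ?case
      using insert.prems assms(3) by (intro bexI [where x = "sup w m"]) (auto intro: le_supI2)
  qed
  then show ?thesis
    using assms(1) by blast
qed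

lemma degree_cong:
  "(\<And>\<alpha>. AtLeast \<alpha> t \<in> S \<longleftrightarrow> AtLeast \<alpha> t' \<in> S) \<Longrightarrow> degree S t = degree S t'"
  by (simp add: degree_def)

text \<open>The side condition of the creation rules: these are the concepts whose classifying names
  are guaranteed to be in the completion.\<close>

definition occurs ::
  "('a, 'x, 'c, 'r, 's, 'h::complete_distrib_lattice) assertion set \<Rightarrow> ('c, 'r, 's) concept \<Rightarrow> bool" where
  "occurs \<A> C \<longleftrightarrow> (\<exists>\<phi>\<in>completion \<A>. C \<in> concepts_in \<phi>)"

lemma subconcepts_trans: "C \<in> subconcepts D \<Longrightarrow> D \<in> subconcepts E \<Longrightarrow> C \<in> subconcepts E"
  by (induction E) auto

text \<open>Makes structural induction on occurring concepts possible.\<close>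

lemma occurs_subconcept:
  assumes "occurs \<A> D" "C \<in> subconcepts D"
  shows "occurs \<A> C"
proof -
  obtain \<phi> where \<phi>: "\<phi> \<in> completion \<A>" "D \<in> concepts_in \<phi>"
    using assms(1) by (auto simp: occurs_def)
  have "C \<in> term_concepts t" if "D \<in> term_concepts t" for t
    using that assms(2) by (cases t) (auto intro: subconcepts_trans)
  with \<phi>(2) have "C \<in> concepts_in \<phi>"
    by (cases \<phi> rule: assertion.exhaust) auto
  then show ?thesis
    using \<phi>(1) by (auto simp: occurs_def)
qed

lemma class_obj_member: "occurs \<A> C \<Longrightarrow> AtLeast top (MemO (ClassObj C) C) \<in> completion \<A>"
  by (auto simp: occurs_def intro: create_obj)

lemma class_feat_member: "occurs \<A> C \<Longrightarrow> AtLeast top (MemF (ClassFeat C) C) \<in> completion \<A>"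
  by (auto simp: occurs_def intro: create_feat)

text \<open>Left to right is the basic rule against the created assertion that
  \<open>ClassFeat C\<close> belongs to \<open>C\<close> to degree \<open>top\<close>; right to left
  is the appending rule.\<close>

lemma member_obj_iff:
  assumes "occurs \<A> C"
  shows "AtLeast \<alpha> (MemO b C) \<in> completion \<A> \<longleftrightarrow> AtLeast \<alpha> (Inc b (ClassFeat C)) \<in> completion \<A>"
  using basic [OF _ class_feat_member [OF assms], of \<alpha> b] append_obj by auto

lemma member_feat_iff:
  assumes "occurs \<A> C"
  shows "AtLeast \<alpha> (MemF y C) \<in> completion \<A> \<longleftrightarrow> AtLeast \<alpha> (Inc (ClassObj C) y) \<in> completion \<A>"
  using basic [OF class_obj_member [OF assms], of \<alpha> y] append_feat by auto

lemma class_obj_in_can_objs: "occurs \<A> C \<Longrightarrow> Some (ClassObj C) \<in> can_objs \<A>"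
  using class_obj_member by (force simp: can_objs_def)

lemma class_feat_in_can_feats: "occurs \<A> C \<Longrightarrow> Some (ClassFeat C) \<in> can_feats \<A>"
  using class_feat_member by (force simp: can_feats_def)

text \<open>An adjunction rule and the matching compatibility rule are converse to each other, so
  both terms carry the same values. This and the next three lemmas supply the columns and rows that
  \<open>compat_boxI\<close> asks for.\<close>

lemma degree_rbox_box: "degree (completion \<A>) (RBox r b y) = degree (completion \<A>) (Inc b (box_name r y))"
  by (rule degree_cong) (blast intro: adj_box_feat compat_box_feat)

lemma degree_rbox_bdia: "degree (completion \<A>) (RBox r b y) = degree (completion \<A>) (Inc (BDiaObj r b) y)"
  by (rule degree_cong) (blast intro: adj_bdia_obj compat_bdia_obj)

lemma degree_rdia_dia: "degree (completion \<A>) (RDia s y b) = degree (completion \<A>) (Inc (dia_name s b) y)"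
  by (rule degree_cong) (blast intro: adj_dia_obj compat_dia_obj)

lemma degree_rdia_bbox: "degree (completion \<A>) (RDia s y b) = degree (completion \<A>) (Inc b (BBoxFeat s y))"
  by (rule degree_cong) (blast intro: adj_bbox_feat compat_bbox_feat)

lemma degree_inc_absent:
  assumes "Some b \<notin> can_objs \<A> \<or> Some y \<notin> can_feats \<A>"
  shows "degree (completion \<A>) (Inc b y) = bot"
proof -
  have "AtLeast \<alpha> (Inc b y) \<notin> completion \<A>" for \<alpha>
    using assms by (force simp: can_objs_def can_feats_def)
  then show ?thesis
    by (simp add: degree_def)
qed


section \<open>The canonical interpretation\<close>

lemma can_interp_simps [simp]:
  "objs (can_interp \<A>) = can_objs \<A>" "feats (can_interp \<A>) = can_feats \<A>"
  "inc (can_interp \<A>) = can_inc \<A>" "rbox (can_interp \<A>) = can_rbox \<A>"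
  "rdia (can_interp \<A>) = can_rdia \<A>" "prim (can_interp \<A>) = can_prim \<A>"
  by (simp_all add: can_interp_def)

lemma None_in_carrier [simp]: "None \<in> can_objs \<A>" "None \<in> can_feats \<A>"
  by (simp_all add: can_objs_def can_feats_def)

lemma can_inc_None [simp]: "can_inc \<A> a None = bot"
  by (cases a) simp_all

lemma can_rbox_None [simp]: "can_rbox \<A> r a None = bot"
  by (cases a) simp_all

lemma can_rdia_None [simp]: "can_rdia \<A> s x None = bot"
  by (cases x) simp_all

text \<open>A derived name that does not occur in the completion is replaced by the fresh element, which
  has the same degrees.\<close>

lemma feat_with_column:
  assumes "\<And>a. f a = can_inc \<A> a (Some y)"
  shows "\<exists>x'\<in>can_feats \<A>. \<forall>a\<in>can_objs \<A>. f a = can_inc \<A> a x'"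
proof (cases "Some y \<in> can_feats \<A>")
  case True
  with assms show ?thesis
    by blast
next
  case False
  have "f a = can_inc \<A> a None" for a
    using False assms by (cases a) (simp_all add: degree_inc_absent)
  then show ?thesis
    using None_in_carrier(2) by blast
qed

lemma obj_with_row:
  assumes "\<And>x. u x = can_inc \<A> (Some b) x"
  shows "\<exists>a'\<in>can_objs \<A>. \<forall>x\<in>can_feats \<A>. u x = can_inc \<A> a' x"
proof (cases "Some b \<in> can_objs \<A>")
  case True
  with assms show ?thesis
    by blast
next
  case False
  have "u x = can_inc \<A> None x" for x
    using False assms by (cases x) (simp_all add: degree_inc_absent)
  then show ?thesis
    using None_in_carrier(1) by blast
qed

text \<open>The column of \<open>y\<close> is the incidence column of \<open>box_name r y\<close>,
  and the row of \<open>b\<close> the incidence row of \<open>BDiaObj r b\<close>. The fresh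
  elements, with all degrees \<open>bot\<close>, correspond to themselves.\<close>

lemma compat_can_rbox: "compat_box (can_interp \<A>) (can_rbox \<A> r)"
proof (rule compat_boxI, simp_all)
  fix x
  show "\<exists>x'\<in>can_feats \<A>. \<forall>a\<in>can_objs \<A>. can_rbox \<A> r a x = can_inc \<A> a x'"
  proof (cases x)
    case (Some y)
    have "can_rbox \<A> r a (Some y) = can_inc \<A> a (Some (box_name r y))" for a
      by (cases a) (simp_all add: degree_rbox_box)
    then show ?thesis
      unfolding Some by (rule feat_with_column)
  qed (auto intro!: bexI [of _ None])
next
  fix a
  show "\<exists>a'\<in>can_objs \<A>. \<forall>x\<in>can_feats \<A>. can_rbox \<A> r a x = can_inc \<A> a' x"
  proof (cases a)
    case (Some b)
    have "can_rbox \<A> r (Some b) x = can_inc \<A> (Some (BDiaObj r b)) x" for x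
      by (cases x) (simp_all add: degree_rbox_bdia)
    then show ?thesis
      unfolding Some by (rule obj_with_row)
  qed (auto intro!: bexI [of _ None])
qed

lemma compat_can_rdia: "compat_dia (can_interp \<A>) (can_rdia \<A> s)"
  unfolding compat_dia_iff_compat_box
proof (rule compat_boxI, simp_all)
  fix x
  show "\<exists>x'\<in>can_feats \<A>. \<forall>a\<in>can_objs \<A>. can_rdia \<A> s x a = can_inc \<A> a x'"
  proof (cases x)
    case (Some y)
    have "can_rdia \<A> s (Some y) a = can_inc \<A> a (Some (BBoxFeat s y))" for a
      by (cases a) (simp_all add: degree_rdia_bbox)
    then show ?thesis
      unfolding Some by (rule feat_with_column)
  qed (auto intro!: bexI [of _ None])
next
  fix a
  show "\<exists>a'\<in>can_objs \<A>. \<forall>x\<in>can_feats \<A>. can_rdia \<A> s x a = can_inc \<A> a' x"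
  proof (cases a)
    case (Some b)
    have "can_rdia \<A> s x (Some b) = can_inc \<A> (Some (dia_name s b)) x" for x
      by (cases x) (simp_all add: degree_rdia_dia)
    then show ?thesis
      unfolding Some by (rule obj_with_row)
  qed (auto intro!: bexI [of _ None])
qed

section \<open>Degrees as attained maxima\<close>

context
  fixes \<A> :: "('a, 'x, 'c, 'r, 's, 'h::complete_distrib_lattice) assertion set"
  assumes finite_abox: "finite \<A>"
begin

abbreviation deg :: "(('a, 'c, 'r, 's) tobj, ('x, 'c, 'r, 's) tfeat, 'c, 'r, 's) fterm \<Rightarrow> 'h" where
  "deg \<equiv> degree (completion \<A>)"

text \<open>The values of \<open>t\<close> are finitely many and closed under joins by
  \<open>mv_join\<close>, so the \<open>GREATEST\<close> in \<open>degree\<close> denotes an actual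
  maximum.\<close>

lemma degree_attained_greatest:
  assumes "AtLeast \<alpha> t \<in> completion \<A>"
  shows "AtLeast (deg t) t \<in> completion \<A> \<and> \<alpha> \<le> deg t"
proof -
  have "\<exists>m\<in>{\<alpha>. AtLeast \<alpha> t \<in> completion \<A>}. \<forall>v\<in>{\<alpha>. AtLeast \<alpha> t \<in> completion \<A>}. v \<le> m"
    using assms by (intro sup_closed_finite_greatest finite_values finite_abox) (auto intro: mv_join)
  then obtain m where "AtLeast m t \<in> completion \<A>" "\<And>v. AtLeast v t \<in> completion \<A> \<Longrightarrow> v \<le> m"
    by auto
  moreover from this have "(GREATEST \<alpha>. AtLeast \<alpha> t \<in> completion \<A>) = m"
    by (rule Greatest_equality)
  ultimately show ?thesis
    using assms by (auto simp: degree_def)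
qed

lemma degree_ge: "AtLeast \<alpha> t \<in> completion \<A> \<Longrightarrow> \<alpha> \<le> deg t"
  using degree_attained_greatest by blast

lemma degree_attained: "deg t = bot \<or> AtLeast (deg t) t \<in> completion \<A>"
proof (cases "\<exists>\<alpha>. AtLeast \<alpha> t \<in> completion \<A>")
  case True
  then show ?thesis
    using degree_attained_greatest by blast
qed (simp add: degree_def)

text \<open>Turns a rule with one premise into an inequality of degrees; the default degree
  \<open>bot\<close> makes the unlisted case trivial. The next lemma does the same for two
  premises.\<close>

lemma degree_mono:
  assumes "\<And>\<alpha>. AtLeast \<alpha> t \<in> completion \<A> \<Longrightarrow> AtLeast \<alpha> t' \<in> completion \<A>"
  shows "deg t \<le> deg t'"
  using degree_attained [of t] by (auto dest: assms degree_ge)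

lemma degree_inf_le:
  assumes "\<And>\<alpha>1 \<alpha>2. AtLeast \<alpha>1 t1 \<in> completion \<A> \<Longrightarrow> AtLeast \<alpha>2 t2 \<in> completion \<A> \<Longrightarrow>
    AtLeast (inf \<alpha>1 \<alpha>2) t \<in> completion \<A>"
  shows "inf (deg t1) (deg t2) \<le> deg t"
  using degree_attained [of t1] degree_attained [of t2] by (auto dest: assms degree_ge)

section \<open>Classifying names of an occurring concept\<close>

context
  fixes C
  assumes C: "occurs \<A> C"
begin

lemma class_degree_top: "deg (Inc (ClassObj C) (ClassFeat C)) = top"
  using degree_ge [OF basic [OF class_obj_member [OF C] class_feat_member [OF C]]]
  by (simp add: top_le)

text \<open>Appending turns the two incidences into memberships in \<open>C\<close>, which the basic
  rule combines; at a fresh element the left side is \<open>bot\<close>.\<close>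

lemma class_incidence:
  "inf (can_inc \<A> a (Some (ClassFeat C))) (can_inc \<A> (Some (ClassObj C)) x) \<le> can_inc \<A> a x"
proof (cases a)
  case (Some b)
  show ?thesis
  proof (cases x)
    case (Some y)
    show ?thesis
      using \<open>a = Some b\<close> Some by (auto intro!: degree_inf_le basic intro: append_obj append_feat)
  qed simp
qed simp

text \<open>The factor at \<open>ClassObj C\<close> has premise \<open>top\<close> and yields the
  upper bound; the lower bound is \<open>class_incidence\<close> by residuation. The next lemma is
  the dual.\<close>

lemma up_class_feat:
  "up (can_interp \<A>) (\<lambda>a. can_inc \<A> a (Some (ClassFeat C))) x = can_inc \<A> (Some (ClassObj C)) x"
  unfolding up_def rel1_def can_interp_simps
proof (rule antisym)
  show "(INF a\<in>can_objs \<A>. can_inc \<A> a (Some (ClassFeat C)) \<rightarrow>\<^sub>H can_inc \<A> a x)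
      \<le> can_inc \<A> (Some (ClassObj C)) x"
    by (rule INF_lower2 [OF class_obj_in_can_objs [OF C]]) (simp add: class_degree_top)
qed (auto intro: INF_greatest simp: le_himp_iff class_incidence)

lemma down_class_obj:
  "down (can_interp \<A>) (can_inc \<A> (Some (ClassObj C))) a = can_inc \<A> a (Some (ClassFeat C))"
  unfolding down_def rel0_def can_interp_simps
proof (rule antisym)
  show "(INF x\<in>can_feats \<A>. can_inc \<A> (Some (ClassObj C)) x \<rightarrow>\<^sub>H can_inc \<A> a x)
      \<le> can_inc \<A> a (Some (ClassFeat C))"
    by (rule INF_lower2 [OF class_feat_in_can_feats [OF C]]) (simp add: class_degree_top)
next
  show "can_inc \<A> a (Some (ClassFeat C))
      \<le> (INF x\<in>can_feats \<A>. can_inc \<A> (Some (ClassObj C)) x \<rightarrow>\<^sub>H can_inc \<A> a x)"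
    using class_incidence by (auto intro!: INF_greatest simp: le_himp_iff inf_commute)
qed

text \<open>Since \<open>box_name\<close> sends \<open>ClassFeat C\<close> to
  \<open>ClassFeat (BoxC r C)\<close>, the right side is the factor of the infimum at
  \<open>ClassFeat C\<close>. That it lies below all other factors is the box rule applied after
  appending. The diamond case below is dual.\<close>

lemma rbox_class_feat:
  "rel0 (can_feats \<A>) (can_rbox \<A> r) (can_inc \<A> (Some (ClassObj C))) a
    = can_inc \<A> a (Some (ClassFeat (BoxC r C)))"
proof -
  have box: "can_inc \<A> a (Some (ClassFeat (BoxC r C))) = can_rbox \<A> r a (Some (ClassFeat C))"
    by (cases a) (simp_all add: degree_rbox_box)
  show ?thesis
    unfolding rel0_def
  proof (rule antisym)
    show "(INF x\<in>can_feats \<A>. can_inc \<A> (Some (ClassObj C)) x \<rightarrow>\<^sub>H can_rbox \<A> r a x)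
        \<le> can_inc \<A> a (Some (ClassFeat (BoxC r C)))"
      unfolding box
      by (rule INF_lower2 [OF class_feat_in_can_feats [OF C]]) (simp add: class_degree_top)
    have "inf (can_inc \<A> a (Some (ClassFeat (BoxC r C)))) (can_inc \<A> (Some (ClassObj C)) x)
        \<le> can_rbox \<A> r a x" for x
      by (cases a; cases x)
        (auto intro!: degree_inf_le intro: completion.box [OF append_obj append_feat])
    then show "can_inc \<A> a (Some (ClassFeat (BoxC r C)))
        \<le> (INF x\<in>can_feats \<A>. can_inc \<A> (Some (ClassObj C)) x \<rightarrow>\<^sub>H can_rbox \<A> r a x)"
      by (auto intro!: INF_greatest simp: le_himp_iff inf_commute)
  qed
qed

lemma rdia_class_obj:
  "rel0 (can_objs \<A>) (can_rdia \<A> s) (\<lambda>a. can_inc \<A> a (Some (ClassFeat C))) x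
    = can_inc \<A> (Some (ClassObj (DiaC s C))) x"
proof -
  have dia: "can_inc \<A> (Some (ClassObj (DiaC s C))) x = can_rdia \<A> s x (Some (ClassObj C))"
    by (cases x) (simp_all add: degree_rdia_dia)
  show ?thesis
    unfolding rel0_def
  proof (rule antisym)
    show "(INF a\<in>can_objs \<A>. can_inc \<A> a (Some (ClassFeat C)) \<rightarrow>\<^sub>H can_rdia \<A> s x a)
        \<le> can_inc \<A> (Some (ClassObj (DiaC s C))) x"
      unfolding dia
      by (rule INF_lower2 [OF class_obj_in_can_objs [OF C]]) (simp add: class_degree_top)
    have "inf (can_inc \<A> (Some (ClassObj (DiaC s C))) x) (can_inc \<A> a (Some (ClassFeat C)))
        \<le> can_rdia \<A> s x a" for a
      by (cases a; cases x)
        (auto intro!: degree_inf_le intro: completion.dia [OF append_feat append_obj])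
    then show "can_inc \<A> (Some (ClassObj (DiaC s C))) x
        \<le> (INF a\<in>can_objs \<A>. can_inc \<A> a (Some (ClassFeat C)) \<rightarrow>\<^sub>H can_rdia \<A> s x a)"
      by (auto intro!: INF_greatest simp: le_himp_iff inf_commute)
  qed
qed

end

section \<open>Values of concepts\<close>

lemma can_prim_occurs:
  assumes "occurs \<A> (Prim D)"
  shows "can_prim \<A> D =
    (\<lambda>a. can_inc \<A> a (Some (ClassFeat (Prim D))), can_inc \<A> (Some (ClassObj (Prim D))))"
  using assms class_obj_in_can_objs [OF assms] class_feat_in_can_feats [OF assms]
  by (auto simp: can_prim_def occurs_def rel0_single rel1_single fun_eq_iff)

text \<open>The conjunction rules speak of membership, so incidences are first translated by
  \<open>member_obj_iff\<close>; then \<open>conj_inv\<close> gives one inequality,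
  \<open>conj1\<close> and \<open>conj2\<close> the other. Disjunction is dual, on the feature
  side.\<close>

lemma conj_class_feat:
  assumes "occurs \<A> (Conj C1 C2)"
  shows "inf (can_inc \<A> a (Some (ClassFeat C1))) (can_inc \<A> a (Some (ClassFeat C2)))
    = can_inc \<A> a (Some (ClassFeat (Conj C1 C2)))"
proof (cases a)
  case (Some b)
  have C12: "occurs \<A> C1" "occurs \<A> C2"
    using assms by (auto elim: occurs_subconcept)
  obtain \<phi> where \<phi>: "\<phi> \<in> completion \<A>" "Conj C1 C2 \<in> concepts_in \<phi>"
    using assms by (auto simp: occurs_def)
  have "inf (deg (Inc b (ClassFeat C1))) (deg (Inc b (ClassFeat C2)))
      \<le> deg (Inc b (ClassFeat (Conj C1 C2)))"
    by (rule degree_inf_le)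
      (simp flip: member_obj_iff [OF assms] member_obj_iff [OF C12(1)] member_obj_iff [OF C12(2)]
        add: conj_inv [OF _ _ \<phi>])
  moreover have "deg (Inc b (ClassFeat (Conj C1 C2))) \<le> deg (Inc b (ClassFeat C1))"
    by (rule degree_mono)
      (simp flip: member_obj_iff [OF assms] member_obj_iff [OF C12(1)] add: conj1)
  moreover have "deg (Inc b (ClassFeat (Conj C1 C2))) \<le> deg (Inc b (ClassFeat C2))"
    by (rule degree_mono)
      (simp flip: member_obj_iff [OF assms] member_obj_iff [OF C12(2)] add: conj2)
  ultimately show ?thesis
    unfolding Some by (simp add: antisym)
qed simp

lemma disj_class_obj:
  assumes "occurs \<A> (Disj C1 C2)"
  shows "inf (can_inc \<A> (Some (ClassObj C1)) x) (can_inc \<A> (Some (ClassObj C2)) x)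
    = can_inc \<A> (Some (ClassObj (Disj C1 C2))) x"
proof (cases x)
  case (Some y)
  have C12: "occurs \<A> C1" "occurs \<A> C2"
    using assms by (auto elim: occurs_subconcept)
  obtain \<phi> where \<phi>: "\<phi> \<in> completion \<A>" "Disj C1 C2 \<in> concepts_in \<phi>"
    using assms by (auto simp: occurs_def)
  have "inf (deg (Inc (ClassObj C1) y)) (deg (Inc (ClassObj C2) y))
      \<le> deg (Inc (ClassObj (Disj C1 C2)) y)"
    by (rule degree_inf_le)
      (simp flip: member_feat_iff [OF assms] member_feat_iff [OF C12(1)] member_feat_iff [OF C12(2)]
        add: disj_inv [OF _ _ \<phi>])
  moreover have "deg (Inc (ClassObj (Disj C1 C2)) y) \<le> deg (Inc (ClassObj C1) y)"
    by (rule degree_mono)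
      (simp flip: member_feat_iff [OF assms] member_feat_iff [OF C12(1)] add: disj1)
  moreover have "deg (Inc (ClassObj (Disj C1 C2)) y) \<le> deg (Inc (ClassObj C2) y)"
    by (rule degree_mono)
      (simp flip: member_feat_iff [OF assms] member_feat_iff [OF C12(2)] add: disj2)
  ultimately show ?thesis
    unfolding Some by (simp add: antisym)
qed simp

text \<open>For each compound concept, the component that \<open>concept_val\<close> computes
  directly is given by one of the lemmas above; the other is its Galois image, found by
  \<open>up_class_feat\<close> or \<open>down_class_obj\<close>.\<close>

lemma concept_val_can_interp:
  assumes "occurs \<A> C"
  shows "concept_val (can_interp \<A>) C =
    (\<lambda>a. can_inc \<A> a (Some (ClassFeat C)), can_inc \<A> (Some (ClassObj C)))"
  using assms
proof (induction C)
  case (Prim D)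
  then show ?case
    by (simp add: can_prim_occurs)
next
  case (Conj C1 C2)
  moreover have "occurs \<A> C1" "occurs \<A> C2"
    using Conj.prems by (auto elim: occurs_subconcept)
  ultimately show ?case
    by (simp add: Let_def conj_class_feat up_class_feat fun_eq_iff)
next
  case (Disj C1 C2)
  moreover have "occurs \<A> C1" "occurs \<A> C2"
    using Disj.prems by (auto elim: occurs_subconcept)
  ultimately show ?case
    by (simp add: Let_def disj_class_obj down_class_obj fun_eq_iff)
next
  case (BoxC r C)
  moreover have C: "occurs \<A> C"
    using BoxC.prems by (auto elim: occurs_subconcept)
  ultimately show ?case
    by (simp add: Let_def rbox_class_feat [OF C, abs_def] up_class_feat fun_eq_iff)
next
  case (DiaC s C)
  moreover have C: "occurs \<A> C"
    using DiaC.prems by (auto elim: occurs_subconcept)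
  ultimately show ?case
    by (simp add: Let_def rdia_class_obj [OF C, abs_def] down_class_obj fun_eq_iff)
qed

lemma is_concept_can_prim: "is_concept (can_interp \<A>) (can_prim \<A> D)"
proof (cases "occurs \<A> (Prim D)")
  case True
  then show ?thesis
    by (simp add: is_concept_def can_prim_occurs up_class_feat down_class_obj)
next
  case False
  then have prim: "can_prim \<A> D = (\<lambda>_. top, up (can_interp \<A>) (\<lambda>_. top))"
    by (auto simp: can_prim_def occurs_def up_def)
  show ?thesis
    unfolding prim is_concept_def
    \<comment> \<open>The constant extent \<open>top\<close> is closed because closure is
      extensive.\<close>
    using down_up_ge [where M = "can_interp \<A>" and f = "\<lambda>_. top"] by (auto intro: top_le)
qed

lemma is_interp_can_interp: "is_interp (can_interp \<A>)"
  by (simp add: is_interp_def compat_can_rbox compat_can_rdia is_concept_can_prim)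
    (simp add: can_interp_def)

section \<open>Satisfaction of the assertions\<close>

lemma names_can_interp:
  assumes "\<phi> \<in> \<A>"
  shows "b \<in> obj_names \<phi> \<Longrightarrow> oname (can_interp \<A>) b = Some (ObjName b)"
    and "y \<in> feat_names \<phi> \<Longrightarrow> fname (can_interp \<A>) y = Some (FeatName y)"
  using input [OF assms]
  by (force simp: can_interp_def can_objs_def can_feats_def assertion.set_map)+

text \<open>Relational terms stay, memberships become incidences with classifying names. Positive
  assertions pass to this form by \<open>member_obj_iff\<close> and \<open>member_feat_iff\<close>,
  negative ones by the negative rules, so a clash can be sought on one common term.\<close>

primrec incidence_term ::
  "(('a, 'c, 'r, 's) tobj, ('x, 'c, 'r, 's) tfeat, 'c, 'r, 's) fterm
    \<Rightarrow> (('a, 'c, 'r, 's) tobj, ('x, 'c, 'r, 's) tfeat, 'c, 'r, 's) fterm" where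
  "incidence_term (Inc b y) = Inc b y"
| "incidence_term (RBox r b y) = RBox r b y"
| "incidence_term (RDia s y b) = RDia s y b"
| "incidence_term (MemO b C) = Inc b (ClassFeat C)"
| "incidence_term (MemF y C) = Inc (ClassObj C) y"

lemma AtLeast_incidence_term:
  assumes "AtLeast \<alpha> t \<in> completion \<A>"
  shows "AtLeast \<alpha> (incidence_term t) \<in> completion \<A>"
proof (cases t)
  case (MemO b C)
  then have "occurs \<A> C"
    using assms by (force simp: occurs_def)
  then show ?thesis
    using assms MemO by (simp add: member_obj_iff)
next
  case (MemF y C)
  then have "occurs \<A> C"
    using assms by (force simp: occurs_def)
  then show ?thesis
    using assms MemF by (simp add: member_feat_iff)
qed (use assms in simp_all)

lemma NotAtLeast_incidence_term:
  "NotAtLeast \<alpha> t \<in> completion \<A> \<Longrightarrow> NotAtLeast \<alpha> (incidence_term t) \<in> completion \<A>"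
  by (cases t) (auto intro: neg_obj neg_feat)

text \<open>Coming from the ABox, \<open>t\<close> has only names that denote themselves and only
  occurring concepts, so \<open>concept_val_can_interp\<close> applies.\<close>

lemma term_val_can_interp:
  assumes "\<phi> \<in> \<A>" "\<phi> = AtLeast \<alpha> t \<or> \<phi> = NotAtLeast \<alpha> t"
  shows "term_val (can_interp \<A>) t = deg (incidence_term (map_fterm ObjName FeatName t))"
proof -
  have "occurs \<A> C" if "C \<in> term_concepts t" for C
  proof -
    have "term_concepts (map_fterm ObjName FeatName t ::
        (('a, 'c, 'r, 's) tobj, ('x, 'c, 'r, 's) tfeat, 'c, 'r, 's) fterm) = term_concepts t"
      by (cases t) simp_all
    then show ?thesis
      using that assms(2) input [OF assms(1)] by (force simp: occurs_def)
  qed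
  moreover have "b \<in> term_objs t \<Longrightarrow> oname (can_interp \<A>) b = Some (ObjName b)"
    and "y \<in> term_feats t \<Longrightarrow> fname (can_interp \<A>) y = Some (FeatName y)" for b y
    using assms by (auto intro!: names_can_interp [OF assms(1)])
  ultimately show ?thesis
    by (cases t) (simp_all add: concept_val_can_interp)
qed

end

theorem theorem3:
  fixes \<A> :: "('a, 'x, 'c, 'r, 's, 'h::complete_distrib_lattice) assertion set"
  assumes "finite \<A>"
    and "\<forall>t. NotAtLeast bot t \<notin> \<A>"
    and "\<not> has_clash (completion \<A>)"
  shows "is_model (can_interp \<A>) \<A>"
proof -
  have "sat (can_interp \<A>) \<phi>" if \<phi>: "\<phi> \<in> \<A>" for \<phi>
  proof (cases \<phi>)
    case (AtLeast \<alpha> t)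
    let ?t = "incidence_term (map_fterm ObjName FeatName t)"
    have "AtLeast \<alpha> ?t \<in> completion \<A>"
      using input [OF \<phi>] AtLeast by (auto intro: AtLeast_incidence_term [OF assms(1)])
    then have "\<alpha> \<le> degree (completion \<A>) ?t"
      by (rule degree_ge [OF assms(1)])
    then show ?thesis
      using term_val_can_interp [OF assms(1) \<phi>] AtLeast by auto
  next
    case (NotAtLeast \<alpha> t)
    let ?t = "incidence_term (map_fterm ObjName FeatName t)"
    have "NotAtLeast \<alpha> ?t \<in> completion \<A>"
      using input [OF \<phi>] NotAtLeast by (auto intro: NotAtLeast_incidence_term [OF assms(1)])
    moreover have "\<alpha> \<noteq> bot"
      using assms(2) \<phi> NotAtLeast by auto
    \<comment> \<open>Otherwise the degree, being above \<alpha> \<noteq> \<open>bot\<close>, is not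
      the default value; it is then listed in the completion and clashes with the negative
      assertion.\<close>
    ultimately have "\<not> \<alpha> \<le> degree (completion \<A>) ?t"
      using degree_attained [OF assms(1), of ?t] assms(3)
      by (auto simp: has_clash_def bot_unique)
    then show ?thesis
      using term_val_can_interp [OF assms(1) \<phi>] NotAtLeast by auto
  qed
  then show ?thesis
    by (simp add: is_model_def is_interp_can_interp [OF assms(1)])
qed

end
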